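(* If $G$ is a subcubic planar graph, then $q_B(G)\le 6$, and this is sharp, i.e. there is a subcubic planar graph $G$ with $q_B(G)=6$.
   Context: All graphs are finite and simple. A graph is subcubic if its maximum degree is at most three. A proper edge coloring of $G$ (incident edges get different colors) is a B-coloring if every 4-cycle of $G$ (as a subgraph, not necessarily induced) is colored with four different colors. $q_B(G)$ is the smallest number of colors needed for a B-coloring of $G$. *)

theory Defs
  imports "HOL-Analysis.Analysis"
begin

text \<open>A graph is a pair of its vertex set and its edge set; an edge is the set of its two ends.\<close>

type_synonym 'a graph = "'a set \<times> 'a set set"

abbreviation verts :: "'a graph \<Rightarrow> 'a set" where
  "verts G \<equiv> fst G"

abbreviation edges :: "'a graph \<Rightarrow> 'a set set" where
  "edges G \<equiv> snd G"

definition simple_graph :: "'a graph \<Rightarrow> bool" where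
  "simple_graph G \<longleftrightarrow> finite (verts G) \<and> (\<forall>e\<in>edges G. e \<subseteq> verts G \<and> card e = 2)"

definition vdegree :: "'a graph \<Rightarrow> 'a \<Rightarrow> nat" where
  "vdegree G v = card {e \<in> edges G. v \<in> e}"

definition subcubic :: "'a graph \<Rightarrow> bool" where
  "subcubic G \<longleftrightarrow> (\<forall>v\<in>verts G. vdegree G v \<le> 3)"

text \<open>A drawing in the plane (taken to be \<^typ>\<open>complex\<close>) places the vertices at the distinct points
  \<open>p v\<close> and draws each edge \<open>e\<close> as an arc \<open>\<gamma> e\<close> (an injective path) joining its ends, such that
  an arc meets the vertex points only in its ends and two arcs meet only in common ends.\<close>

definition plane_drawing :: "'a graph \<Rightarrow> ('a \<Rightarrow> complex) \<Rightarrow> ('a set \<Rightarrow> real \<Rightarrow> complex) \<Rightarrow> bool" where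
  "plane_drawing G p \<gamma> \<longleftrightarrow>
     inj_on p (verts G) \<and>
     (\<forall>e\<in>edges G. arc (\<gamma> e) \<and> {pathstart (\<gamma> e), pathfinish (\<gamma> e)} = p ` e \<and>
        path_image (\<gamma> e) \<inter> p ` verts G = p ` e) \<and>
     (\<forall>e\<in>edges G. \<forall>f\<in>edges G. e \<noteq> f \<longrightarrow>
        path_image (\<gamma> e) \<inter> path_image (\<gamma> f) = p ` (e \<inter> f))"

definition planar :: "'a graph \<Rightarrow> bool" where
  "planar G \<longleftrightarrow> (\<exists>p \<gamma>. plane_drawing G p \<gamma>)"

definition proper_edge_coloring :: "'a graph \<Rightarrow> ('a set \<Rightarrow> nat) \<Rightarrow> bool" where
  "proper_edge_coloring G c \<longleftrightarrow>
     (\<forall>e\<in>edges G. \<forall>f\<in>edges G. e \<noteq> f \<and> e \<inter> f \<noteq> {} \<longrightarrow> c e \<noteq> c f)"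

definition four_cycle :: "'a graph \<Rightarrow> 'a \<Rightarrow> 'a \<Rightarrow> 'a \<Rightarrow> 'a \<Rightarrow> bool" where
  "four_cycle G u v w x \<longleftrightarrow>
     distinct [u, v, w, x] \<and> {{u, v}, {v, w}, {w, x}, {x, u}} \<subseteq> edges G"

definition B_coloring :: "'a graph \<Rightarrow> ('a set \<Rightarrow> nat) \<Rightarrow> bool" where
  "B_coloring G c \<longleftrightarrow> proper_edge_coloring G c \<and>
     (\<forall>u v w x. four_cycle G u v w x \<longrightarrow>
        distinct [c {u, v}, c {v, w}, c {w, x}, c {x, u}])"

definition q_B :: "'a graph \<Rightarrow> nat" where
  "q_B G = (LEAST k. \<exists>c. B_coloring G c \<and> c ` edges G \<subseteq> {..<k})"

text \<open>The minimum is over a nonempty set: an injective coloring of the finitely many edges is a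
  B-coloring.\<close>

lemma q_B_attained:
  assumes "simple_graph G"
  shows "\<exists>c. B_coloring G c \<and> c ` edges G \<subseteq> {..<q_B G}"
proof -
  have "edges G \<subseteq> Pow (verts G)" and "finite (verts G)"
    using assms by (auto simp: simple_graph_def)
  then have "finite (edges G)"
    by (meson finite_Pow_iff finite_subset)
  then obtain c :: "'a set \<Rightarrow> nat" and n where c: "c ` edges G = {i. i < n}" "inj_on c (edges G)"
    using finite_imp_inj_to_nat_seg by metis
  have "proper_edge_coloring G c"
    using c(2) by (auto simp: proper_edge_coloring_def inj_on_def)
  moreover have "distinct [c {u, v}, c {v, w}, c {w, x}, c {x, u}]" if "four_cycle G u v w x" for u v w x
    using that inj_on_eq_iff[OF c(2)] by (auto simp: four_cycle_def doubleton_eq_iff)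
  ultimately have "B_coloring G c"
    by (simp add: B_coloring_def)
  with c(1) have "\<exists>k c. B_coloring G c \<and> c ` edges G \<subseteq> {..<k}"
    by (metis lessThan_def order_refl)
  then show ?thesis
    unfolding q_B_def by (rule LeastI_ex)
qed

end

theory Submission imports Defs begin

text \<open>
  Planarity enters only through the absence of a \<open>K\<^sub>3\<^sub>,\<^sub>3\<close> subgraph: a subcubic graph without one has
  \<open>q\<^sub>B \<le> 6\<close>. (In \<open>K\<^sub>3\<^sub>,\<^sub>3\<close> itself any two edges conflict, so it needs nine colors.)

  Call two edges conflicting if they share an end or are opposite in a 4-cycle; a B-coloring is a
  coloring without equally colored conflicting edges. An edge with at most five conflicts in a set
  \<open>S\<close> of edges can be colored after the rest of \<open>S\<close>, so the only difficult sets are the cores, in which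
  every edge has at least six conflicts. An edge \<open>{u, v}\<close> has at most four incident edges and needs
  two opposite ones. If two opposite edges share an end, then \<open>{u, v}\<close> lies in a \<open>K\<^sub>2\<^sub>,\<^sub>3\<close>; without
  \<open>K\<^sub>3\<^sub>,\<^sub>3\<close>, at some vertex of the side of size three the edge that leaves the \<open>K\<^sub>2\<^sub>,\<^sub>3\<close>, if any, is in
  no 4-cycle, and peeling off edges from there shows that no edge of a \<open>K\<^sub>2\<^sub>,\<^sub>3\<close> is in a core
  (lemma \<open>K23_not_core\<close>). So each edge of a core is the middle edge of two squares side by side, all of
  whose edges are in the core (lemma \<open>core_domino\<close>), and following these squares around closes up to the
  graph of the 3-dimensional cube (lemma \<open>core_cube\<close>). A cube is a whole component, because the graph is
  subcubic. It has twelve edges, and antipodal ones do not conflict: six colors suffice.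

  That a plane graph has no \<open>K\<^sub>3\<^sub>,\<^sub>3\<close> is proved from the Jordan curve theorem: the three chords of a
  Hamiltonian hexagon pairwise cross, so no two are on the same side of it, but it has two sides only.

  The bound is attained by \<open>K\<^sub>4\<close>, in which any two of the six edges conflict.
\<close>

section \<open>A plane graph contains no complete bipartite graph on three plus three vertices\<close>

text \<open>Here \<open>L \<union> M\<close> is a closed curve, \<open>D\<close> one of its sides, and \<open>K\<close> and \<open>g\<close> are two chords whose ends
  interleave: \<open>K\<close> contains the common points of the halves \<open>L\<close> and \<open>M\<close>, and \<open>g\<close> runs from \<open>L\<close> to
  \<open>M\<close>. Suppose that both avoid \<open>D\<close>. An inner point of \<open>g\<close> reaches \<open>D\<close> along \<open>g\<close> through its end on \<open>M\<close>
  without touching \<open>K \<union> L\<close>, and through its end on \<open>L\<close> without touching \<open>K \<union> M\<close>. Since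
  \<open>(K \<union> L) \<inter> (K \<union> M) = K\<close> is connected, Janiszewski's theorem says that the union of the two does not
  separate the point from \<open>D\<close> either, which is absurd as the point is on the other side of \<open>L \<union> M\<close>.
  Both the inside and the outside of the curve can take the place of \<open>D\<close>.\<close>

lemma crossing_chords_meet_both_sides:
  fixes D K L M :: "complex set"
  assumes compact: "compact K" "compact L" "compact M"
    and K: "connected K" "L \<inter> M \<subseteq> K" "K \<inter> D = {}"
    and D: "open D" "connected D" "D \<noteq> {}" "frontier D = L \<union> M"
    and Q: "arc g" "path_image g \<inter> (K \<union> L \<union> M) = {pathstart g, pathfinish g}"
    and ends: "pathstart g \<in> L - (K \<union> M)" "pathfinish g \<in> M - (K \<union> L)"
  shows "path_image g \<inter> D \<noteq> {}"
proof
  assume gD: "path_image g \<inter> D = {}"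
  let ?Q = "path_image g"
  have D_off: "D \<inter> (K \<union> L \<union> M) = {}"
    using D(1,4) K(3) frontier_disjoint_eq[of D] by blast
  obtain y where y: "y \<in> D"
    using D(3) by blast
  have "?Q - {pathstart g, pathfinish g} \<noteq> {}"
    using Q(1) arc_imp_simple_path nonempty_simple_path_endless by blast
  then obtain x where x: "x \<in> ?Q" "x \<noteq> pathstart g" "x \<noteq> pathfinish g"
    by blast
  have Q_minus: "connected (?Q - {pathstart g})" "connected (?Q - {pathfinish g})"
  proof -
    have inj: "inj_on g {0..1}" and cont: "continuous_on {0..1} g"
      using Q(1) by (auto simp: arc_def path_def)
    have "?Q - {pathstart g} = g ` {0<..1}" "?Q - {pathfinish g} = g ` {0..<1}"
      using inj_on_eq_iff[OF inj]
      by (force simp: path_image_def pathstart_def pathfinish_def image_iff less_le)+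
    moreover have "connected (g ` {0<..1})" "connected (g ` {0..<1})"
      by (rule connected_continuous_image, rule continuous_on_subset[OF cont], auto)+
    ultimately show "connected (?Q - {pathstart g})" "connected (?Q - {pathfinish g})"
      by auto
  qed
  \<comment> \<open>The set \<open>R\<close> leads from \<open>x\<close> to a point \<open>z\<close> of the curve, which is in the closure of \<open>D\<close>.\<close>
  have link: "connected_component (- T) x y"
    if T: "closed T" "T \<subseteq> K \<union> L \<union> M" and z: "z \<in> L \<union> M" "z \<notin> T"
      and R: "connected R" "x \<in> R" "z \<in> R" "R \<inter> T = {}" for T R z
  proof -
    have "z \<in> closure D"
      using z(1) D(4) by (auto simp: frontier_def)
    then have "connected (insert z D)"
      by (intro connected_intermediate_closure[OF D(2)]) (auto intro: closure_subset[THEN subsetD])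
    then have "connected (R \<union> insert z D)"
      using R by (intro connected_Un) auto
    moreover have "R \<union> insert z D \<subseteq> - T"
      using R(4) z(2) T(2) D_off by blast
    ultimately show ?thesis
      unfolding connected_component_def using R(2) y by blast
  qed
  have closed: "closed K" "closed L" "closed M"
    using compact compact_imp_closed by auto
  have QL: "(?Q - {pathstart g}) \<inter> (K \<union> L) = {}" and QM: "(?Q - {pathfinish g}) \<inter> (K \<union> M) = {}"
    using equalityD1[OF Q(2)] ends by auto
  have neq: "pathstart g \<noteq> pathfinish g"
    using ends by auto
  have "connected_component (- (K \<union> L)) x y"
    by (rule link[where z = "pathfinish g" and R = "?Q - {pathstart g}"])
      (use closed ends Q_minus x neq pathfinish_in_path_image[of g] QL in \<open>simp_all add: closed_Un le_supI1\<close>)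
  moreover have "connected_component (- (K \<union> M)) x y"
    by (rule link[where z = "pathstart g" and R = "?Q - {pathfinish g}"])
      (use closed ends Q_minus x neq pathstart_in_path_image[of g] QM in \<open>simp_all add: closed_Un le_supI1\<close>)
  moreover have "(K \<union> L) \<inter> (K \<union> M) = K"
    using K(2) by blast
  ultimately have "connected_component (- ((K \<union> L) \<union> (K \<union> M))) x y"
    using K(1) compact closed by (intro Janiszewski[of "K \<union> L" "K \<union> M"]) (simp_all only: compact_Un closed_Un)
  then obtain C where C: "connected C" "C \<subseteq> - ((K \<union> L) \<union> (K \<union> M))" "x \<in> C" "y \<in> C"
    by (auto simp: connected_component_def)
  have "C \<inter> frontier D \<noteq> {}"
    using C(1,3,4) y x(1) gD by (intro connected_Int_frontier) blast+
  then show False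
    using C(2) D(4) by blast
qed

text \<open>The arc \<open>h i j\<close> joins the point \<open>A i\<close> to the point \<open>B j\<close>, for indices below 3. The six arcs with
  \<open>i \<noteq> j\<close> form a hexagon, and the arcs \<open>h i i\<close> are its three long diagonals; this choice keeps the
  description symmetric under permutations of the indices.\<close>

locale plane_K33 =
  fixes A B :: "nat \<Rightarrow> complex" and h :: "nat \<Rightarrow> nat \<Rightarrow> real \<Rightarrow> complex"
  assumes arc: "\<lbrakk>i < 3; j < 3\<rbrakk> \<Longrightarrow> arc (h i j)"
    and start: "\<lbrakk>i < 3; j < 3\<rbrakk> \<Longrightarrow> pathstart (h i j) = A i"
    and finish: "\<lbrakk>i < 3; j < 3\<rbrakk> \<Longrightarrow> pathfinish (h i j) = B j"
    and meet: "\<lbrakk>i < 3; j < 3; k < 3; l < 3; (i, j) \<noteq> (k, l)\<rbrakk> \<Longrightarrow>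
      path_image (h i j) \<inter> path_image (h k l) =
        (if i = k then {A i} else {}) \<union> (if j = l then {B j} else {})"
    and A_on: "\<lbrakk>i < 3; j < 3; m < 3\<rbrakk> \<Longrightarrow> A m \<in> path_image (h i j) \<longleftrightarrow> m = i"
    and B_on: "\<lbrakk>i < 3; j < 3; m < 3\<rbrakk> \<Longrightarrow> B m \<in> path_image (h i j) \<longleftrightarrow> m = j"
begin

definition hexagon :: "complex set" where
  "hexagon = (\<Union>i<3. \<Union>j\<in>{..<3} - {i}. path_image (h i j))"

text \<open>The two halves into which the ends of the diagonal \<open>h i i\<close> cut the hexagon, each an arc from \<open>A i\<close> to
  \<open>B i\<close> through two of the other four vertices.\<close>

lemma hexagon_split:
  assumes "distinct [i, k, l]" "i < 3" "k < 3" "l < 3"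
  shows "hexagon =
    (path_image (h i k) \<union> path_image (h l k) \<union> path_image (h l i)) \<union>
    (path_image (h i l) \<union> path_image (h k l) \<union> path_image (h k i))"
proof -
  have "{..<3} = {i, k, l}"
    using assms by auto
  then show ?thesis
    unfolding hexagon_def using assms(1) by auto
qed

lemma hexagon_Jordan:
  obtains J where "simple_path J" "pathfinish J = pathstart J" "path_image J = hexagon"
proof -
  define P where "P = h 0 1 +++ (reversepath (h 2 1) +++ h 2 0)"
  define Q where "Q = reversepath (h 1 0) +++ (h 1 2 +++ reversepath (h 0 2))"
  note s = start finish arc
  have P: "arc P" "pathstart P = A 0" "pathfinish P = B 0"
    "path_image P = path_image (h 0 1) \<union> path_image (h 2 1) \<union> path_image (h 2 0)"
    unfolding P_def using meet[of 0 1 2 1] meet[of 0 1 2 0] meet[of 2 1 2 0]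
    by (auto simp: s arc_reversepath path_image_join intro!: arc_join)
  have Q: "arc Q" "pathstart Q = B 0" "pathfinish Q = A 0"
    "path_image Q = path_image (h 1 0) \<union> path_image (h 1 2) \<union> path_image (h 0 2)"
    unfolding Q_def using meet[of 1 0 1 2] meet[of 1 0 0 2] meet[of 1 2 0 2]
    by (auto simp: s arc_reversepath path_image_join intro!: arc_join)
  have "path_image P \<inter> path_image Q \<subseteq> {A 0, B 0}"
    unfolding P(4) Q(4)
    using meet[of 0 1 1 0] meet[of 0 1 1 2] meet[of 0 1 0 2]
      meet[of 2 1 1 0] meet[of 2 1 1 2] meet[of 2 1 0 2]
      meet[of 2 0 1 0] meet[of 2 0 1 2] meet[of 2 0 0 2] by auto
  then have "simple_path (P +++ Q)"
    using P Q by (intro simple_path_join_loop) auto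
  moreover have "path_image (P +++ Q) = hexagon"
    using P Q hexagon_split[of 0 1 2] by (auto simp: path_image_join)
  ultimately show ?thesis
    using that[of "P +++ Q"] P Q by simp
qed

lemma chord_Int_hexagon:
  assumes "i < 3"
  shows "path_image (h i i) \<inter> hexagon = {A i, B i}"
proof -
  obtain k l where kl: "distinct [i, k, l]" "k < 3" "l < 3"
  proof -
    have "i = 0 \<or> i = 1 \<or> i = 2" using assms by auto
    then show ?thesis using that[of 1 2] that[of 0 2] that[of 0 1] by fastforce
  qed
  show ?thesis
    unfolding hexagon_split[OF kl(1) assms kl(2,3)]
    using meet[of i i i k] meet[of i i l k] meet[of i i l i]
      meet[of i i i l] meet[of i i k l] meet[of i i k i] kl assms by auto
qed

lemma chord_avoids_side:
  assumes "open U" "open V" "U \<inter> V = {}" "U \<union> V = - hexagon" "i < 3"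
  shows "path_image (h i i) \<inter> U = {} \<or> path_image (h i i) \<inter> V = {}"
proof -
  have "connected (path_image (h i i) - {A i, B i})"
    using connected_simple_path_endless[of "h i i"] arc_imp_simple_path[OF arc] start finish assms(5)
    by simp
  moreover have "path_image (h i i) - {A i, B i} = path_image (h i i) - hexagon"
    using chord_Int_hexagon[OF assms(5)] by blast
  ultimately have "U \<inter> (path_image (h i i) - hexagon) = {} \<or> V \<inter> (path_image (h i i) - hexagon) = {}"
    by (intro connectedD) (use assms(1-4) in auto)
  moreover have "U \<inter> hexagon = {}" "V \<inter> hexagon = {}"
    using equalityD1[OF assms(4)] by auto
  ultimately show ?thesis
    by blast
qed

lemma two_chords_not_on_same_side:
  assumes ikl: "distinct [i, k, l]" "i < 3" "k < 3" "l < 3"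
    and D: "open D" "connected D" "D \<noteq> {}" "frontier D = hexagon"
    and "path_image (h i i) \<inter> D = {}"
  shows "path_image (h k k) \<inter> D \<noteq> {}"
proof -
  let ?M = "path_image (h i k) \<union> path_image (h l k) \<union> path_image (h l i)"
  let ?L = "path_image (h i l) \<union> path_image (h k l) \<union> path_image (h k i)"
  have ik: "i \<noteq> k" "i \<noteq> l" "k \<noteq> l" using ikl(1) by auto
  have "compact (path_image (h m n))" if "m < 3" "n < 3" for m n
    by (simp add: arc that compact_arc_image)
  then have c: "compact (path_image (h i i))" "compact ?L" "compact ?M"
    using ikl by auto
  have split: "hexagon = ?L \<union> ?M"
    using hexagon_split[OF ikl] by blast
  have LM: "?L \<inter> ?M \<subseteq> path_image (h i i)"
    using ik ikl(2-4) by (simp add: Int_Un_distrib Int_Un_distrib2 meet A_on B_on)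
  have ki: "path_image (h k k) \<inter> path_image (h i i) = {}"
    using meet[of k k i i] ik ikl by auto
  show ?thesis
  proof (rule crossing_chords_meet_both_sides[OF c _ LM assms(9) D(1,2,3)])
    show "connected (path_image (h i i))"
      by (simp add: arc connected_arc_image ikl(2))
    show "frontier D = ?L \<union> ?M" using split D(4) by simp
    show "arc (h k k)" using arc ikl by simp
    show "path_image (h k k) \<inter> (path_image (h i i) \<union> ?L \<union> ?M) = {pathstart (h k k), pathfinish (h k k)}"
      using chord_Int_hexagon[OF ikl(3)] ki ikl unfolding split by (simp add: start finish) blast
    show "pathstart (h k k) \<in> ?L - (path_image (h i i) \<union> ?M)"
      using ik ikl(2-4) by (simp add: start A_on)
    show "pathfinish (h k k) \<in> ?M - (path_image (h i i) \<union> ?L)"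
      using ik ikl(2-4) by (simp add: finish B_on)
  qed
qed

text \<open>Each of the three diagonals avoids the inside or the outside, so two of them avoid the same side.\<close>

lemma impossible: False
proof -
  obtain J where J: "simple_path J" "pathfinish J = pathstart J" "path_image J = hexagon"
    by (rule hexagon_Jordan)
  let ?I = "inside hexagon" and ?O = "outside hexagon"
  note jordan = Jordan_inside_outside[OF J(1,2), unfolded J(3)]
  have same: "\<not> (path_image (h i i) \<inter> D = {} \<and> path_image (h k k) \<inter> D = {})"
    if "i < 3" "k < 3" "i \<noteq> k" "D \<in> {?I, ?O}" for i k D
  proof -
    obtain l where "distinct [i, k, l]" "l < 3"
    proof -
      have "\<exists>l\<in>{0, 1, 2}. distinct [i, k, l]"
        using \<open>i < 3\<close> \<open>k < 3\<close> \<open>i \<noteq> k\<close> by auto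
      then show ?thesis using that by fastforce
    qed
    then show ?thesis
      using two_chords_not_on_same_side[of i k l D] that jordan by auto
  qed
  have side: "path_image (h i i) \<inter> ?I = {} \<or> path_image (h i i) \<inter> ?O = {}" if "i < 3" for i
    using chord_avoids_side[of ?I ?O i] that jordan by blast
  show False
    using side[of 0] side[of 1] side[of 2] same[of 0 1 ?I] same[of 0 2 ?I] same[of 1 2 ?I]
      same[of 0 1 ?O] same[of 0 2 ?O] same[of 1 2 ?O] by auto
qed

end

definition has_K33 :: "'a graph \<Rightarrow> bool" where
  "has_K33 G \<longleftrightarrow> (\<exists>(a :: nat \<Rightarrow> 'a) (b :: nat \<Rightarrow> 'a). inj_on a {..<3} \<and> inj_on b {..<3} \<and>
     a ` {..<3} \<inter> b ` {..<3} = {} \<and> (\<forall>i<3. \<forall>j<3. {a i, b j} \<in> edges G))"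

lemma planar_no_K33:
  assumes "simple_graph G" "planar G"
  shows "\<not> has_K33 G"
proof
  assume "has_K33 G"
  then obtain a b where ab: "inj_on a {..<3 :: nat} \<and> inj_on b {..<3 :: nat} \<and>
     a ` {..<3} \<inter> b ` {..<3} = {} \<and> (\<forall>i<3. \<forall>j<3. {a i, b j} \<in> edges G)"
    unfolding has_K33_def by (elim exE) (rule that)
  then have inj: "inj_on a {..<3}" "inj_on b {..<3}" and disj: "a ` {..<3} \<inter> b ` {..<3} = {}"
    and E: "\<And>i j. \<lbrakk>i < 3; j < 3\<rbrakk> \<Longrightarrow> {a i, b j} \<in> edges G"
    by auto
  obtain p \<gamma> where pd: "plane_drawing G p \<gamma>"
    using assms(2) by (auto simp: planar_def)
  have pd_meet: "path_image (\<gamma> e) \<inter> path_image (\<gamma> f) = p ` (e \<inter> f)"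
    if "e \<in> edges G" "f \<in> edges G" "e \<noteq> f" for e f
    using pd that by (simp add: plane_drawing_def)
  have eq[simp]: "a i = a k \<longleftrightarrow> i = k" "b i = b k \<longleftrightarrow> i = k" "a i \<noteq> b k" "b k \<noteq> a i"
    if "i < 3" "k < 3" for i k
    using that inj_on_eq_iff[OF inj(1)] inj_on_eq_iff[OF inj(2)] disj by auto
  have V: "a i \<in> verts G" "b i \<in> verts G" if "i < 3" for i
    using E[OF that that] assms(1) by (auto simp: simple_graph_def)
  have p: "p v = p w \<longleftrightarrow> v = w" if "v \<in> verts G" "w \<in> verts G" for v w
    using pd that by (auto simp: plane_drawing_def inj_on_def)
  define h where "h i j = (let g = \<gamma> {a i, b j} in if pathstart g = p (a i) then g else reversepath g)" for i j
  have im: "path_image (h i j) = path_image (\<gamma> {a i, b j})" for i j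
    by (simp add: h_def Let_def)
  have ends: "arc (h i j) \<and> pathstart (h i j) = p (a i) \<and> pathfinish (h i j) = p (b j)"
    if "i < 3" "j < 3" for i j
  proof -
    have "arc (\<gamma> {a i, b j})" "{pathstart (\<gamma> {a i, b j}), pathfinish (\<gamma> {a i, b j})} = {p (a i), p (b j)}"
      using pd E[OF that] by (auto simp: plane_drawing_def)
    then show ?thesis
      by (auto simp: h_def Let_def doubleton_eq_iff arc_reversepath)
  qed
  have on: "p v \<in> path_image (h i j) \<longleftrightarrow> v = a i \<or> v = b j" if "i < 3" "j < 3" "v \<in> verts G" for i j v
  proof -
    have "path_image (\<gamma> {a i, b j}) \<inter> p ` verts G = {p (a i), p (b j)}"
      using pd E[OF that(1,2)] by (auto simp: plane_drawing_def)
    then have "p v \<in> path_image (\<gamma> {a i, b j}) \<longleftrightarrow> p v \<in> {p (a i), p (b j)}"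
      using that(3) by blast
    then show ?thesis
      using that V by (simp add: im p)
  qed
  interpret plane_K33 "\<lambda>i. p (a i)" "\<lambda>j. p (b j)" h
  proof
    fix i j k l :: nat assume *: "i < 3" "j < 3" "k < 3" "l < 3" "(i, j) \<noteq> (k, l)"
    have "{a i, b j} \<noteq> {a k, b l}"
      using * by (auto simp: doubleton_eq_iff)
    then have "path_image (h i j) \<inter> path_image (h k l) = p ` ({a i, b j} \<inter> {a k, b l})"
      using pd_meet[OF E[OF *(1,2)] E[OF *(3,4)]] by (simp add: im)
    also have "{a i, b j} \<inter> {a k, b l} = (if i = k then {a i} else {}) \<union> (if j = l then {b j} else {})"
      using * by auto
    finally show "path_image (h i j) \<inter> path_image (h k l) =
        (if i = k then {p (a i)} else {}) \<union> (if j = l then {p (b j)} else {})"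
      by auto
  qed (use ends on V in \<open>auto\<close>)
  show False by (rule impossible)
qed

section \<open>Conflicting edges\<close>

text \<open>The relation on edges whose proper colorings are the B-colorings.\<close>

definition conflict :: "'a graph \<Rightarrow> 'a set \<Rightarrow> 'a set \<Rightarrow> bool" where
  "conflict G e f \<longleftrightarrow> e \<noteq> f \<and>
     (e \<inter> f \<noteq> {} \<or> (\<exists>u v w x. four_cycle G u v w x \<and> e = {u, v} \<and> f = {w, x}))"

lemma conflict_sym: "conflict G e f \<Longrightarrow> conflict G f e"
proof -
  assume ef: "conflict G e f"
  have "four_cycle G w x u v" if "four_cycle G u v w x" for u v w x
    using that by (auto simp: four_cycle_def)
  then show ?thesis
    using ef unfolding conflict_def by (metis Int_commute)
qed

lemma B_coloringI:
  assumes "\<And>e f. \<lbrakk>e \<in> edges G; f \<in> edges G; conflict G e f\<rbrakk> \<Longrightarrow> c e \<noteq> c f"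
  shows "B_coloring G c"
  unfolding B_coloring_def
proof (intro conjI allI impI)
  show "proper_edge_coloring G c"
    using assms by (auto simp: proper_edge_coloring_def conflict_def)
  fix u v w x assume cyc: "four_cycle G u v w x"
  then have d: "distinct [u, v, w, x]"
    and E: "{u, v} \<in> edges G" "{v, w} \<in> edges G" "{w, x} \<in> edges G" "{x, u} \<in> edges G"
    by (auto simp: four_cycle_def)
  have "four_cycle G v w x u"
    using cyc by (auto simp: four_cycle_def)
  then have "conflict G {u, v} {w, x}" "conflict G {v, w} {x, u}"
    "conflict G {u, v} {v, w}" "conflict G {v, w} {w, x}" "conflict G {w, x} {x, u}"
    "conflict G {u, v} {x, u}"
    using d cyc unfolding conflict_def by (auto simp: doubleton_eq_iff)
  then show "distinct [c {u, v}, c {v, w}, c {w, x}, c {x, u}]"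
    using assms E by simp
qed

locale subcubic_K33_free =
  fixes G :: "'a graph"
  assumes simple: "simple_graph G" and subcubic: "subcubic G" and no_K33: "\<not> has_K33 G"
begin

definition adj :: "'a \<Rightarrow> 'a \<Rightarrow> bool" where
  "adj u v \<longleftrightarrow> {u, v} \<in> edges G"

lemma adj_sym: "adj u v \<Longrightarrow> adj v u"
  by (simp add: adj_def insert_commute)

lemma adj_neq: "adj u v \<Longrightarrow> u \<noteq> v"
  using simple by (fastforce simp: adj_def simple_graph_def)

lemma edgeE:
  assumes "e \<in> edges G"
  obtains u v where "e = {u, v}" "adj u v"
  using assms simple by (auto simp: adj_def simple_graph_def card_2_iff)

lemma finite_edges: "finite (edges G)"
proof -
  have "edges G \<subseteq> Pow (verts G)" "finite (verts G)"
    using simple by (auto simp: simple_graph_def)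
  then show ?thesis
    by (meson finite_Pow_iff finite_subset)
qed

lemma finite_nbrs: "finite {y. adj v y}"
proof (rule finite_subset)
  show "{y. adj v y} \<subseteq> verts G" "finite (verts G)"
    using simple by (auto simp: simple_graph_def adj_def)
qed

lemma card_nbrs: "card {y. adj v y} \<le> 3"
proof (cases "{y. adj v y} = {}")
  case False
  then have "v \<in> verts G"
    using simple by (auto simp: simple_graph_def adj_def)
  have "card {y. adj v y} \<le> card {e \<in> edges G. v \<in> e}"
  proof (rule card_inj_on_le)
    show "inj_on (\<lambda>y. {v, y}) {y. adj v y}"
      by (auto simp: inj_on_def doubleton_eq_iff)
    show "finite {e \<in> edges G. v \<in> e}"
      using finite_edges by simp
  qed (auto simp: adj_def)
  also have "\<dots> \<le> 3"
    using subcubic \<open>v \<in> verts G\<close> by (simp add: subcubic_def vdegree_def)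
  finally show ?thesis .
qed (metis card.empty zero_le)

lemma nbrs_eqI:
  assumes "adj v a" "adj v b" "adj v c" "distinct [a, b, c]"
  shows "{y. adj v y} = {a, b, c}"
proof -
  have "{a, b, c} = {y. adj v y}"
    using assms card_nbrs[of v] by (intro card_seteq[OF finite_nbrs]) auto
  then show ?thesis ..
qed

lemma obtain_nbrs:
  assumes "adj v a"
  obtains b c where "{y. adj v y} \<subseteq> {a, b, c}"
proof -
  have "card ({y. adj v y} - {a}) \<le> 2"
    using assms card_nbrs[of v] finite_nbrs[of v] by (simp add: card_Diff_singleton)
  moreover have "finite ({y. adj v y} - {a})"
    using finite_nbrs by simp
  ultimately obtain b c where "{y. adj v y} - {a} \<subseteq> {b, c}"
  proof -
    let ?N = "{y. adj v y} - {a}"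
    assume *: "finite ?N" "card ?N \<le> 2" and **: "\<And>b c. ?N \<subseteq> {b, c} \<Longrightarrow> thesis"
    then consider "card ?N = 0" | "card ?N = 1" | "card ?N = 2" by linarith
    then show thesis
      using *(1) ** by cases (auto simp: card_1_singleton_iff card_2_iff simp del: Collect_empty_eq)
  qed
  then show ?thesis
    using that by blast
qed

lemma obtain_third_nbr:
  assumes "adj v a" "adj v b" "a \<noteq> b"
  obtains c where "{y. adj v y} \<subseteq> {a, b, c}"
proof -
  obtain c d where "{y. adj v y} \<subseteq> {a, c, d}"
    using obtain_nbrs[OF assms(1)] .
  then show ?thesis
    using that assms by blast
qed

text \<open>The conflicts of an edge \<open>{u, v}\<close>, read off from the neighbors of \<open>u\<close> and \<open>v\<close>. All bounds on numbers
  of conflicts below come from this list, with at most two choices for \<open>x\<close> and at most two for \<open>w\<close>.\<close>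

lemma conflict_cases:
  assumes "conflict G {u, v} f" "f \<in> edges G"
  obtains (left) x where "f = {u, x}" "adj u x" "x \<noteq> v"
  | (right) w where "f = {v, w}" "adj v w" "w \<noteq> u"
  | (opposite) x w where "f = {x, w}" "adj u x" "x \<noteq> v" "adj v w" "w \<noteq> u" "adj x w"
proof (cases "{u, v} \<inter> f = {}")
  case False
  obtain a b where f: "f = {a, b}" "adj a b"
    using assms(2) by (rule edgeE)
  have "f \<noteq> {u, v}"
    using assms(1) by (auto simp: conflict_def)
  with False f adj_sym[OF f(2)] show ?thesis
    using left[of a] left[of b] right[of a] right[of b] by (auto simp: insert_commute)
next
  case True
  then obtain u' v' w x where cyc: "four_cycle G u' v' w x" "{u, v} = {u', v'}" "f = {w, x}"
    using assms(1) by (auto simp: conflict_def)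
  then have "adj v' w" "adj w x" "adj x u'" "x \<noteq> v'" "w \<noteq> u'"
    by (auto simp: four_cycle_def adj_def)
  then show ?thesis
    using cyc(2,3) opposite[of x w] opposite[of w x] adj_sym
    by (auto simp: doubleton_eq_iff insert_commute)
qed

section \<open>Cores\<close>

text \<open>The sets that cannot be shortened by setting aside an edge with at most five conflicts; every set of
  edges for which six colors do not suffice contains a nonempty one.\<close>

definition core :: "'a set set \<Rightarrow> bool" where
  "core S \<longleftrightarrow> S \<subseteq> edges G \<and> (\<forall>e\<in>S. 6 \<le> card {f \<in> S. conflict G e f})"

lemma core_edges: "\<lbrakk>core S; {u, v} \<in> S\<rbrakk> \<Longrightarrow> adj u v"
  by (auto simp: core_def adj_def)

lemma core_few_conflicts:
  assumes "core S" "e \<in> S" "{f \<in> S. conflict G e f} \<subseteq> F" "finite F" "card F \<le> 5"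
  shows False
  using assms card_mono[of F "{f \<in> S. conflict G e f}"] unfolding core_def by fastforce

lemma card_le_5: "card {a, b, c, d, e} \<le> 5"
  by (simp add: card_insert_if)

text \<open>The usual way to exclude an edge from a core. The five edges named may coincide.\<close>

lemma core_not_five:
  assumes "core S" "e \<in> S" 
    and "\<And>f. \<lbrakk>f \<in> S; conflict G e f\<rbrakk> \<Longrightarrow> f \<in> {a, b, c, d, g}"
  shows False
  by (rule core_few_conflicts[OF assms(1,2) _ _ card_le_5[of a b c d g]]) (use assms(3) in auto)

text \<open>Incidence alone accounts for at most four conflicts.\<close>

lemma core_opposite:
  assumes "core S" "{u, v} \<in> S"
  shows "\<exists>x w. adj u x \<and> x \<noteq> v \<and> adj v w \<and> w \<noteq> u \<and> adj x w"
proof (rule ccontr)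
  assume none: "\<not> ?thesis"
  have uv: "adj u v" using assms core_edges by blast
  obtain x1 x2 where x: "{y. adj u y} \<subseteq> {v, x1, x2}"
    using obtain_nbrs[OF uv] .
  obtain w1 w2 where w: "{y. adj v y} \<subseteq> {u, w1, w2}"
    using obtain_nbrs[OF adj_sym[OF uv]] .
  show False
  proof (rule core_not_five[OF assms])
    fix f assume f: "f \<in> S" "conflict G {u, v} f"
    then have "f \<in> edges G" using assms(1) by (auto simp: core_def)
    with f(2) show "f \<in> {{u, x1}, {u, x2}, {v, w1}, {v, w2}, {v, w2}}"
    proof (cases rule: conflict_cases)
      case (left x)
      then show ?thesis using x by auto
    next
      case (right y)
      then show ?thesis using w by auto
    next
      case opposite
      then show ?thesis using none by blast
    qed
  qed
qed

text \<open>Let \<open>a\<close> and \<open>b\<close> have the common neighbors \<open>c1\<close>, \<open>c2\<close>, \<open>c3\<close>, and suppose that no other neighbor of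
  \<open>c1\<close> is adjacent to \<open>c2\<close> or to \<open>c3\<close>. Then a third edge at \<open>c1\<close> has no opposite edge and is not in the
  core. This leaves \<open>{a, c1}\<close> and \<open>{b, c1}\<close> only the five other edges of the \<open>K\<^sub>2\<^sub>,\<^sub>3\<close> as conflicts, so
  they are not in the core, and without these two the edge \<open>{a, c2}\<close> has at most five conflicts, too.\<close>

lemma K23_unshared_not_core:
  assumes "core S" "distinct [c1, c2, c3]" "a \<noteq> b"
    and ca: "adj a c1" "adj a c2" "adj a c3" and cb: "adj b c1" "adj b c2" "adj b c3"
    and unshared: "\<And>d. \<lbrakk>adj c1 d; d \<noteq> a; d \<noteq> b\<rbrakk> \<Longrightarrow> \<not> adj d c2 \<and> \<not> adj d c3"
  shows "{a, c1} \<notin> S" "{a, c2} \<notin> S"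
proof -
  have Na: "{y. adj a y} = {c1, c2, c3}" and Nb: "{y. adj b y} = {c1, c2, c3}"
    by (intro nbrs_eqI; use assms in simp)+
  have S: "f \<in> edges G" if "f \<in> S" for f
    using that assms(1) by (auto simp: core_def)
  have sym: "adj x y \<longleftrightarrow> adj y x" for x y
    using adj_sym by blast
  have Na': "adj a y \<longleftrightarrow> y \<in> {c1, c2, c3}" and Nb': "adj b y \<longleftrightarrow> y \<in> {c1, c2, c3}" for y
    using Na Nb by auto
  obtain d1 where d1: "{y. adj c1 y} \<subseteq> {a, b, d1}"
    using obtain_third_nbr[of c1 a b] assms adj_sym by blast
  have exit: "{c1, d} \<notin> S" if "d \<noteq> a" "d \<noteq> b" for d
  proof
    assume "{c1, d} \<in> S"
    then obtain x w where "adj c1 x" "x \<noteq> d" "adj d w" "w \<noteq> c1" "adj x w" and "adj c1 d"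
      using core_opposite[OF assms(1)] core_edges[OF assms(1)] by blast
    moreover from this have "x = a \<or> x = b"
      using d1 that by blast
    ultimately show False
      using unshared[of d] that Na' Nb' by auto
  qed
  have first: "{a', c1} \<notin> S" if "{a', b'} = {a, b}" for a' b'
  proof
    assume S1: "{a', c1} \<in> S"
    have a': "a' = a \<and> b' = b \<or> a' = b \<and> b' = a"
      using that by (auto simp: doubleton_eq_iff)
    have N: "adj a' y \<Longrightarrow> y = c1 \<or> y = c2 \<or> y = c3" for y
      using a' Na' Nb' by blast
    show False
    proof (rule core_not_five[OF assms(1) S1])
      fix f assume f: "f \<in> S" "conflict G {a', c1} f"
      show "f \<in> {{a', c2}, {a', c3}, {c1, b'}, {b', c2}, {b', c3}}"
        using f(2) S[OF f(1)]
      proof (cases rule: conflict_cases)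
        case (left x)
        then show ?thesis using N[of x] by blast
      next
        case (right w)
        then have "w = b'" using exit[of w] f(1) a' by blast
        then show ?thesis using right(1) by blast
      next
        case (opposite x w)
        then have x: "x = c2 \<or> x = c3" using N[of x] by blast
        then have "w = a \<or> w = b"
          using unshared[of w] opposite adj_sym by blast
        then have "w = b'"
          using a' opposite(5) by blast
        then show ?thesis using opposite(1) x by (auto simp: insert_commute)
      qed
    qed
  qed
  show "{a, c1} \<notin> S" using first[of a b] by simp
  have bc1: "{b, c1} \<notin> S" "{a, c1} \<notin> S" using first[of b a] first[of a b] by auto
  obtain d2 where d2: "{y. adj c2 y} \<subseteq> {a, b, d2}"
    using obtain_third_nbr[of c2 a b] assms adj_sym by blast
  show "{a, c2} \<notin> S"
  proof
    assume S2: "{a, c2} \<in> S"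
    show False
    proof (rule core_not_five[OF assms(1) S2])
      fix f assume f: "f \<in> S" "conflict G {a, c2} f"
      show "f \<in> {{a, c3}, {c2, b}, {c2, d2}, {b, c3}, {d2, c3}}"
        using f(2) S[OF f(1)]
      proof (cases rule: conflict_cases)
        case (left x)
        then have "x = c3" using Na'[of x] f(1) bc1 by blast
        then show ?thesis using left(1) by blast
      next
        case (right w)
        then have "w = b \<or> w = d2" using d2 by blast
        then show ?thesis using right(1) by blast
      next
        case (opposite x w)
        then have x: "x = c1 \<or> x = c3" using Na'[of x] by blast
        have w: "w = b \<or> w = d2 \<and> w \<noteq> a \<and> w \<noteq> b" using opposite d2 by blast
        have "x \<noteq> c1"
        proof
          assume [simp]: "x = c1"
          have "w \<noteq> b"
            using bc1 f(1) opposite(1) by (auto simp: insert_commute)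
          then show False
            using w unshared[of w] opposite(4-6) adj_sym[of c2 w] by simp
        qed
        then show ?thesis using x w opposite(1) by (auto simp: insert_commute)
      qed
    qed
  qed
qed

text \<open>If the third neighbors of \<open>c1\<close>, \<open>c2\<close>, \<open>c3\<close> were all shared, they would be one vertex, which together
  with \<open>a\<close> and \<open>b\<close> would form a \<open>K\<^sub>3\<^sub>,\<^sub>3\<close>. So the previous lemma applies after renumbering.\<close>

lemma K23_not_core:
  assumes "core S" "distinct [c1, c2, c3]" "a \<noteq> b"
    and ca: "adj a c1" "adj a c2" "adj a c3" and cb: "adj b c1" "adj b c2" "adj b c3"
  shows "{a, c1} \<notin> S"
proof -
  let ?priv = "\<lambda>c c' c''. \<forall>d. adj c d \<and> d \<noteq> a \<and> d \<noteq> b \<longrightarrow> \<not> adj d c' \<and> \<not> adj d c''"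
  have "?priv c1 c2 c3 \<or> ?priv c2 c1 c3 \<or> ?priv c3 c1 c2"
  proof (rule ccontr)
    assume no: "\<not> ?thesis"
    then obtain d1 d2 d3 where d: "adj c1 d1" "d1 \<noteq> a" "d1 \<noteq> b" "adj d1 c2 \<or> adj d1 c3"
      "adj c2 d2" "d2 \<noteq> a" "d2 \<noteq> b" "adj d2 c1 \<or> adj d2 c3"
      "adj c3 d3" "d3 \<noteq> a" "d3 \<noteq> b" "adj d3 c1 \<or> adj d3 c2"
      by blast
    have N: "{y. adj c1 y} = {a, b, d1}" "{y. adj c2 y} = {a, b, d2}" "{y. adj c3 y} = {a, b, d3}"
      by (intro nbrs_eqI; use d assms adj_sym in simp)+
    \<comment> \<open>Whichever of the \<open>c\<close> the vertices \<open>d\<close> are shared with, they are its only third neighbor.\<close>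
    have "d1 = d2 \<and> d1 = d3"
      using N d adj_sym by blast
    then have dc: "adj d1 c1" "adj d1 c2" "adj d1 c3"
      using d adj_sym by blast+
    let ?A = "\<lambda>i :: nat. if i = 0 then a else if i = 1 then b else d1"
    let ?B = "\<lambda>i :: nat. if i = 0 then c1 else if i = 1 then c2 else c3"
    have "inj_on ?A {..<3}" "inj_on ?B {..<3}"
      using assms(2,3) d(2,3) by (auto simp: inj_on_def)
    moreover have "?A ` {..<3} \<inter> ?B ` {..<3} = {}"
      using dc[THEN adj_neq] ca[THEN adj_neq] cb[THEN adj_neq] by auto
    moreover have "\<forall>i<3. \<forall>j<3. {?A i, ?B j} \<in> edges G"
      using dc ca cb by (auto simp: adj_def)
    ultimately have "has_K33 G"
      unfolding has_K33_def by blast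
    then show False
      using no_K33 by blast
  qed
  then consider "?priv c1 c2 c3" | "?priv c2 c1 c3" | "?priv c3 c1 c2"
    by blast
  then show ?thesis
  proof cases
    case 1
    then show ?thesis
      using K23_unshared_not_core(1)[of S c1 c2 c3 a b] assms by blast
  next
    case 2
    then show ?thesis
      using K23_unshared_not_core(2)[of S c2 c1 c3 a b] assms by auto
  next
    case 3
    then show ?thesis
      using K23_unshared_not_core(2)[of S c3 c1 c2 a b] assms by auto
  qed
qed

text \<open>With only one further neighbor \<open>x\<close> of \<open>u\<close> there would be three incident edges and two candidates for
  opposite ones.\<close>

lemma core_degree:
  assumes "core S" "{u, v} \<in> S"
  obtains x1 x2 where "{y. adj u y} = {v, x1, x2}" "distinct [v, x1, x2]"
proof -
  have uv: "adj u v" using assms core_edges by blast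
  obtain x w where x: "adj u x" "x \<noteq> v"
    using core_opposite[OF assms] by blast
  obtain x' where x': "{y. adj u y} \<subseteq> {v, x, x'}"
    using obtain_third_nbr[OF uv x(1)] x(2) by blast
  obtain w1 w2 where w: "{y. adj v y} \<subseteq> {u, w1, w2}"
    using obtain_nbrs[OF adj_sym[OF uv]] .
  have "adj u x' \<and> x' \<noteq> v \<and> x' \<noteq> x"
  proof (rule ccontr)
    assume no: "\<not> ?thesis"
    have nbr: "y = x" if "adj u y" "y \<noteq> v" for y
      using that no x' by blast
    show False
    proof (rule core_not_five[OF assms])
      fix f assume f: "f \<in> S" "conflict G {u, v} f"
      then have "f \<in> edges G" using assms(1) by (auto simp: core_def)
      with f(2) show "f \<in> {{u, x}, {v, w1}, {v, w2}, {x, w1}, {x, w2}}"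
      proof (cases rule: conflict_cases)
        case (left y)
        then show ?thesis using nbr by auto
      next
        case (right y)
        then show ?thesis using w by auto
      next
        case (opposite y z)
        then have "y = x" "z \<in> {w1, w2}" using nbr w by blast+
        then show ?thesis using opposite(1) by auto
      qed
    qed
  qed
  then show ?thesis
    using x x' uv that[of x x'] by auto
qed

text \<open>Two opposite edges that share an end would make \<open>{u, v}\<close> an edge of a \<open>K\<^sub>2\<^sub>,\<^sub>3\<close>. So the opposite edges,
  of which there are at least two, form a matching between the other neighbors of \<open>u\<close> and of \<open>v\<close>. Then
  \<open>{u, v}\<close> has exactly six conflicts, and all six are in the core. If \<open>{u, v}\<close> were in a triangle, its apex
  would have degree four, or the two opposite edges would coincide.\<close>

lemma core_domino:
  assumes "core S" "{u, v} \<in> S"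
  obtains x1 x2 w1 w2 where "distinct [u, v, x1, x2, w1, w2]"
    "{y. adj u y} = {v, x1, x2}" "{y. adj v y} = {u, w1, w2}"
    "adj x1 w1" "adj x2 w2" "\<not> adj x1 w2" "\<not> adj x2 w1"
    "{{u, x1}, {u, x2}, {v, w1}, {v, w2}, {x1, w1}, {x2, w2}} \<subseteq> S"
proof -
  have uv: "adj u v" "adj v u" using assms core_edges adj_sym by blast+
  obtain x1 x2 where x: "{y. adj u y} = {v, x1, x2}" "distinct [v, x1, x2]"
    using core_degree[OF assms] .
  have vu: "{v, u} \<in> S" using assms(2) by (simp add: insert_commute)
  obtain y1 y2 where y: "{y. adj v y} = {u, y1, y2}" "distinct [u, y1, y2]"
    using core_degree[OF assms(1) vu] .
  have fork1: "\<not> (adj z y1 \<and> adj z y2)" if "adj u z" "z \<noteq> v" for z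
    using K23_not_core[OF assms(1), of u y1 y2 v z] y uv that adj_sym vu by auto
  have fork2: "\<not> (adj x1 z \<and> adj x2 z)" if "adj v z" "z \<noteq> u" for z
    using K23_not_core[OF assms(1), of v x1 x2 u z] x uv that adj_sym assms(2) by auto
  have forks: "\<not> (adj x1 y1 \<and> adj x1 y2)" "\<not> (adj x2 y1 \<and> adj x2 y2)"
    "\<not> (adj x1 y1 \<and> adj x2 y1)" "\<not> (adj x1 y2 \<and> adj x2 y2)"
    using fork1[of x1] fork1[of x2] fork2[of y1] fork2[of y2] x y by auto
  have neighbours: "f \<in> {{u, x1}, {u, x2}, {v, y1}, {v, y2}} \<or>
      (\<exists>x\<in>{x1, x2}. \<exists>y\<in>{y1, y2}. adj x y \<and> f = {x, y})"
    if f: "f \<in> S" "conflict G {u, v} f" for f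
  proof -
    have "f \<in> edges G" using assms(1) f by (auto simp: core_def)
    with f(2) show ?thesis
    proof (cases rule: conflict_cases)
      case (left z)
      then have "z = x1 \<or> z = x2" using x(1) by blast
      then show ?thesis using left(1) by blast
    next
      case (right z)
      then have "z = y1 \<or> z = y2" using y(1) by blast
      then show ?thesis using right(1) by blast
    next
      case (opposite z w)
      then have "z \<in> {x1, x2}" "w \<in> {y1, y2}" using x(1) y(1) by blast+
      then show ?thesis using opposite(1,6) by blast
    qed
  qed
  have "\<exists>w1 w2. {w1, w2} = {y1, y2} \<and> w1 \<noteq> w2 \<and> adj x1 w1 \<and> adj x2 w2"
  proof (rule ccontr)
    assume "\<not> ?thesis"
    then have no: "\<not> (adj x1 y1 \<and> adj x2 y2)" "\<not> (adj x1 y2 \<and> adj x2 y1)"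
      using y(2) by (auto simp: insert_commute)
    \<comment> \<open>The only edge that can still be opposite to \<open>{u, v}\<close>.\<close>
    define g where "g = (if adj x1 y1 then {x1, y1} else if adj x1 y2 then {x1, y2}
      else if adj x2 y1 then {x2, y1} else {x2, y2})"
    have g: "{x, y} = g" if "x = x1 \<or> x = x2" "y = y1 \<or> y = y2" "adj x y" for x y
      using that forks no unfolding g_def by (elim disjE) simp_all
    show False
    proof (rule core_not_five[OF assms])
      fix f assume f: "f \<in> S" "conflict G {u, v} f"
      show "f \<in> {{u, x1}, {u, x2}, {v, y1}, {v, y2}, g}"
        using neighbours[OF f]
      proof (elim disjE bexE conjE)
        fix x y assume "x \<in> {x1, x2}" "y \<in> {y1, y2}" "adj x y" "f = {x, y}"
        then show ?thesis using g[of x y] by simp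
      qed (elim insertE emptyE; simp)
    qed
  qed
  then obtain w1 w2 where w: "{w1, w2} = {y1, y2}" "w1 \<noteq> w2" "adj x1 w1" "adj x2 w2"
    by blast
  have Nv: "{y. adj v y} = {u, w1, w2}" "distinct [u, w1, w2]"
    using y w(1,2) by (auto simp: doubleton_eq_iff)
  have cross: "\<not> adj x1 w2" "\<not> adj x2 w1"
    using forks w by (auto simp: doubleton_eq_iff)
  let ?F = "{{u, x1}, {u, x2}, {v, w1}, {v, w2}, {x1, w1}, {x2, w2}}"
  have ww: "w1 = y1 \<and> w2 = y2 \<or> w1 = y2 \<and> w2 = y1"
    using w(1) by (simp add: doubleton_eq_iff)
  have sub: "{f \<in> S. conflict G {u, v} f} \<subseteq> ?F"
  proof (rule subsetI, elim CollectE conjE)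
    fix f assume f: "f \<in> S" "conflict G {u, v} f"
    show "f \<in> ?F"
      using neighbours[OF f]
    proof (elim disjE bexE conjE)
      assume "f \<in> {{u, x1}, {u, x2}, {v, y1}, {v, y2}}"
      then show ?thesis
        using ww by (elim insertE emptyE disjE conjE; simp)
    next
      fix x y assume f: "x \<in> {x1, x2}" "y \<in> {y1, y2}" "adj x y" "f = {x, y}"
      then have "x = x1 \<or> x = x2" "y = w1 \<or> y = w2"
        using ww by auto
      then show ?thesis
        using f(3,4) cross by (elim disjE; simp)
    qed
  qed
  have six: "6 \<le> card {f \<in> S. conflict G {u, v} f}"
    using assms by (auto simp: core_def)
  have F6: "card ?F \<le> 6"
    by (simp add: card_insert_if)
  have eq: "{f \<in> S. conflict G {u, v} f} = ?F"
    using sub six F6 by (intro card_seteq) auto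
  have "{x1, w1} \<noteq> {x2, w2}"
  proof
    assume "{x1, w1} = {x2, w2}"
    then have "?F = {{u, x1}, {u, x2}, {v, w1}, {v, w2}, {x1, w1}}"
      by auto
    then show False
      using card_le_5[of "{u, x1}" "{u, x2}" "{v, w1}" "{v, w2}" "{x1, w1}"] six eq by simp
  qed
  have four: False if "adj z a" "adj z b" "adj z c" "adj z d" "distinct [a, b, c, d]" for z a b c d
    using nbrs_eqI[of z a b c] that by auto
  have nb: "adj u x1" "adj u x2" "adj v w1" "adj v w2"
    using x(1) Nv(1) by auto
  have "x1 \<noteq> w2"
  proof
    assume "x1 = w2"
    then show False
      using four[of x1 u v w1 x2] \<open>{x1, w1} \<noteq> {x2, w2}\<close> nb w(3,4) nb[THEN adj_sym]
        adj_sym[OF w(4)] x(2) Nv(2) uv[THEN adj_neq] nb[THEN adj_neq] by auto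
  qed
  moreover have "x2 \<noteq> w1"
  proof
    assume "x2 = w1"
    then show False
      using four[of x2 u v w2 x1] \<open>{x1, w1} \<noteq> {x2, w2}\<close> nb w(3,4) nb[THEN adj_sym]
        adj_sym[OF w(3)] x(2) Nv(2) uv[THEN adj_neq] nb[THEN adj_neq] by auto
  qed
  ultimately have "distinct [u, v, x1, x2, w1, w2]"
    using x(2) Nv(2) uv[THEN adj_neq] nb[THEN adj_neq] w(3,4)[THEN adj_neq] by auto
  moreover have "?F \<subseteq> S" using eq by blast
  ultimately show ?thesis
    using that[of x1 x2 w1 w2] x(1) Nv(1) w(3,4) cross by blast
qed

text \<open>The form of the previous lemma used to walk along a core: a path of length two that starts with an edge
  of the core and continues at its end \<open>u\<close> closes up to a square in the core, and is not in a triangle.\<close>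

lemma core_square:
  assumes "core S" "{u, v} \<in> S" "adj u x" "x \<noteq> v"
  obtains w where "adj v w" "w \<noteq> u" "adj x w" "\<not> adj x v"
    "{u, x} \<in> S" "{v, w} \<in> S" "{x, w} \<in> S"
proof -
  obtain x1 x2 w1 w2 where d: "distinct [u, v, x1, x2, w1, w2]"
    "{y. adj u y} = {v, x1, x2}" "{y. adj v y} = {u, w1, w2}"
    "adj x1 w1" "adj x2 w2"
    "{{u, x1}, {u, x2}, {v, w1}, {v, w2}, {x1, w1}, {x2, w2}} \<subseteq> S"
    using core_domino[OF assms(1,2)] by metis
  have "x = x1 \<or> x = x2"
    using assms(3,4) d(2) by blast
  moreover have Nv: "adj v y \<longleftrightarrow> y = u \<or> y = w1 \<or> y = w2" for y
    using d(3) by blast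
  moreover have "\<not> adj x1 v" "\<not> adj x2 v"
    using d(1) Nv[of x1] Nv[of x2] adj_sym[of x1 v] adj_sym[of x2 v] by auto
  ultimately show ?thesis
    using that[of w1] that[of w2] d by auto
qed

section \<open>Cubes, and coloring with six colors\<close>

text \<open>The vertices of a cube graph: \<open>u\<close> is antipodal to \<open>s\<close>, and each \<open>v\<^sub>i\<close> to \<open>w\<^sub>i\<close>.\<close>

definition cube :: "'a \<Rightarrow> 'a \<Rightarrow> 'a \<Rightarrow> 'a \<Rightarrow> 'a \<Rightarrow> 'a \<Rightarrow> 'a \<Rightarrow> 'a \<Rightarrow> bool" where
  "cube u v1 v2 v3 w1 w2 w3 s \<longleftrightarrow> distinct [u, v1, v2, v3, w1, w2, w3, s] \<and>
     adj u v1 \<and> adj u v2 \<and> adj u v3 \<and> adj s w1 \<and> adj s w2 \<and> adj s w3 \<and>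
     adj v1 w2 \<and> adj v1 w3 \<and> adj v2 w1 \<and> adj v2 w3 \<and> adj v3 w1 \<and> adj v3 w2"

definition antipodal_pairs ::
  "'a \<Rightarrow> 'a \<Rightarrow> 'a \<Rightarrow> 'a \<Rightarrow> 'a \<Rightarrow> 'a \<Rightarrow> 'a \<Rightarrow> 'a \<Rightarrow> 'a set set list" where
  "antipodal_pairs u v1 v2 v3 w1 w2 w3 s =
     [{{u, v1}, {s, w1}}, {{u, v2}, {s, w2}}, {{u, v3}, {s, w3}},
      {{v1, w2}, {w1, v2}}, {{v1, w3}, {w1, v3}}, {{v2, w3}, {w2, v3}}]"

text \<open>Together these symmetries move any edge of the cube to any other, so that it suffices to examine one edge.\<close>

lemma cube_swap:
  assumes "cube u v1 v2 v3 w1 w2 w3 s"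
  shows "cube u v2 v1 v3 w2 w1 w3 s" "cube u v3 v2 v1 w3 w2 w1 s"
    "cube s w1 w2 w3 v1 v2 v3 u" "cube v1 u w2 w3 s v2 v3 w1"
  using assms unfolding cube_def by (auto intro: adj_sym)

text \<open>Every vertex of a cube has its three neighbors in the cube. So the conflicts of \<open>{u, v1}\<close> are four
  incident edges and the opposite edges in the two squares through \<open>{u, v1}\<close>; the antipodal edge
  \<open>{s, w1}\<close> is not among them.\<close>

lemma cube_conflict:
  assumes cube: "cube u v1 v2 v3 w1 w2 w3 s" and f: "conflict G {u, v1} f" "f \<in> edges G"
  shows "f \<in> {{u, v2}, {u, v3}, {v1, w2}, {v1, w3}, {v2, w3}, {v3, w2}}"
proof -
  have d: "distinct [u, v1, v2, v3, w1, w2, w3, s]"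
    and a: "adj u v1" "adj u v2" "adj u v3" "adj v1 u" "adj v1 w2" "adj v1 w3"
      "adj v2 u" "adj v2 w1" "adj v2 w3" "adj v3 u" "adj v3 w1" "adj v3 w2"
    using cube by (auto simp: cube_def intro: adj_sym)
  have N: "{y. adj u y} = {v1, v2, v3}" "{y. adj v1 y} = {u, w2, w3}"
    "{y. adj v2 y} = {u, w1, w3}" "{y. adj v3 y} = {u, w1, w2}"
    by (intro nbrs_eqI; use a d in simp)+
  show ?thesis
    using f
  proof (cases rule: conflict_cases)
    case (left x)
    then have "x = v2 \<or> x = v3" using N(1) by blast
    then show ?thesis using left(1) by (elim disjE) simp_all
  next
    case (right w)
    then have "w = w2 \<or> w = w3" using N(2) by blast
    then show ?thesis using right(1) by (elim disjE) simp_all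
  next
    case (opposite x w)
    then have x: "x = v2 \<or> x = v3" and w: "w = w2 \<or> w = w3" using N(1,2) by blast+
    have "w \<in> {y. adj x y}" using opposite by simp
    then have "x = v2 \<and> w = w3 \<or> x = v3 \<and> w = w2"
      using x w N(3,4) d by auto
    then show ?thesis using opposite(1) by (elim disjE conjE) simp_all
  qed
qed

text \<open>The pairs are color classes, and a cube can be colored independently of all other edges.\<close>

lemma antipodal_pairs_conflict:
  assumes cube: "cube u v1 v2 v3 w1 w2 w3 s"
    and P: "P \<in> set (antipodal_pairs u v1 v2 v3 w1 w2 w3 s)" and "e \<in> P"
    and f: "conflict G e f" "f \<in> edges G"
  shows "f \<in> \<Union> (set (antipodal_pairs u v1 v2 v3 w1 w2 w3 s)) - P"
proof -
  note sym = cube_swap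
  have d: "distinct [u, v1, v2, v3, w1, w2, w3, s]" "distinct [s, w3, w2, w1, v3, v2, v1, u]"
    using cube by (auto simp: cube_def)
  have c2: "cube u v2 v1 v3 w2 w1 w3 s" using sym(1)[OF cube] .
  have c3: "cube u v3 v2 v1 w3 w2 w1 s" using sym(2)[OF cube] .
  have s1: "cube s w1 w2 w3 v1 v2 v3 u" using sym(3)[OF cube] .
  have s2: "cube s w2 w1 w3 v2 v1 v3 u" using sym(1)[OF s1] .
  have s3: "cube s w3 w2 w1 v3 v2 v1 u" using sym(2)[OF s1] .
  let ?C = "\<Union> (set (antipodal_pairs u v1 v2 v3 w1 w2 w3 s))"
  have n0: "f \<in> ?C - {{u, v1}, {s, w1}}" if "conflict G {u, v1} f"
    using cube_conflict[OF cube that f(2)] d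
    by (elim insertE emptyE; simp add: antipodal_pairs_def doubleton_eq_iff)
  have n1: "f \<in> ?C - {{u, v2}, {s, w2}}" if "conflict G {u, v2} f"
    using cube_conflict[OF c2 that f(2)] d
    by (elim insertE emptyE; simp add: antipodal_pairs_def doubleton_eq_iff)
  have n2: "f \<in> ?C - {{u, v3}, {s, w3}}" if "conflict G {u, v3} f"
    using cube_conflict[OF c3 that f(2)] d
    by (elim insertE emptyE; simp add: antipodal_pairs_def doubleton_eq_iff)
  have n3: "f \<in> ?C - {{u, v1}, {s, w1}}" if "conflict G {s, w1} f"
    using cube_conflict[OF s1 that f(2)] d
    by (elim insertE emptyE; simp add: antipodal_pairs_def doubleton_eq_iff)
  have n4: "f \<in> ?C - {{u, v2}, {s, w2}}" if "conflict G {s, w2} f"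
    using cube_conflict[OF s2 that f(2)] d
    by (elim insertE emptyE; simp add: antipodal_pairs_def doubleton_eq_iff)
  have n5: "f \<in> ?C - {{u, v3}, {s, w3}}" if "conflict G {s, w3} f"
    using cube_conflict[OF s3 that f(2)] d
    by (elim insertE emptyE; simp add: antipodal_pairs_def doubleton_eq_iff)
  have n6: "f \<in> ?C - {{v1, w2}, {w1, v2}}" if "conflict G {v1, w2} f"
    using cube_conflict[OF sym(1)[OF sym(4)[OF cube]] that f(2)] d
    by (elim insertE emptyE; simp add: antipodal_pairs_def doubleton_eq_iff)
  have n7: "f \<in> ?C - {{v1, w3}, {w1, v3}}" if "conflict G {v1, w3} f"
    using cube_conflict[OF sym(2)[OF sym(4)[OF cube]] that f(2)] d
    by (elim insertE emptyE; simp add: antipodal_pairs_def doubleton_eq_iff)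
  have n8: "f \<in> ?C - {{v2, w3}, {w2, v3}}" if "conflict G {v2, w3} f"
    using cube_conflict[OF sym(2)[OF sym(4)[OF c2]] that f(2)] d
    by (elim insertE emptyE; simp add: antipodal_pairs_def doubleton_eq_iff)
  have n9: "f \<in> ?C - {{v1, w2}, {w1, v2}}" if "conflict G {w1, v2} f"
    using cube_conflict[OF sym(4)[OF sym(1)[OF sym(4)[OF c2]]] that f(2)] d
    by (elim insertE emptyE; simp add: antipodal_pairs_def doubleton_eq_iff)
  have n10: "f \<in> ?C - {{v1, w3}, {w1, v3}}" if "conflict G {w1, v3} f"
    using cube_conflict[OF sym(4)[OF sym(2)[OF sym(4)[OF c3]]] that f(2)] d
    by (elim insertE emptyE; simp add: antipodal_pairs_def doubleton_eq_iff)
  have n11: "f \<in> ?C - {{v2, w3}, {w2, v3}}" if "conflict G {w2, v3} f"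
    using cube_conflict[OF sym(4)[OF sym(1)[OF sym(4)[OF c3]]] that f(2)] d
    by (elim insertE emptyE; simp add: antipodal_pairs_def doubleton_eq_iff)
  have "P = {{u, v1}, {s, w1}} \<or>
      P = {{u, v2}, {s, w2}} \<or>
      P = {{u, v3}, {s, w3}} \<or>
      P = {{v1, w2}, {w1, v2}} \<or>
      P = {{v1, w3}, {w1, v3}} \<or>
      P = {{v2, w3}, {w2, v3}}"
    using P by (simp add: antipodal_pairs_def)
  then show ?thesis
  proof (elim disjE)
    assume P: "P = {{u, v1}, {s, w1}}"
    show ?thesis
      using n0 n3 f(1) \<open>e \<in> P\<close> unfolding P by (elim insertE emptyE; simp only:)
  next
    assume P: "P = {{u, v2}, {s, w2}}"
    show ?thesis
      using n1 n4 f(1) \<open>e \<in> P\<close> unfolding P by (elim insertE emptyE; simp only:)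
  next
    assume P: "P = {{u, v3}, {s, w3}}"
    show ?thesis
      using n2 n5 f(1) \<open>e \<in> P\<close> unfolding P by (elim insertE emptyE; simp only:)
  next
    assume P: "P = {{v1, w2}, {w1, v2}}"
    show ?thesis
      using n6 n9 f(1) \<open>e \<in> P\<close> unfolding P by (elim insertE emptyE; simp only:)
  next
    assume P: "P = {{v1, w3}, {w1, v3}}"
    show ?thesis
      using n7 n10 f(1) \<open>e \<in> P\<close> unfolding P by (elim insertE emptyE; simp only:)
  next
    assume P: "P = {{v2, w3}, {w2, v3}}"
    show ?thesis
      using n8 n11 f(1) \<open>e \<in> P\<close> unfolding P by (elim insertE emptyE; simp only:)
  qed
qed

text \<open>Start at an edge \<open>{u, v1}\<close>. The squares through the three pairs of edges at \<open>u\<close> give the vertices \<open>w\<^sub>i\<close>,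
  and the third neighbor of \<open>w3\<close> is common to \<open>w2\<close> and \<open>w1\<close>, by the squares at \<open>v1\<close> and at \<open>v2\<close>.\<close>

lemma core_cube:
  assumes "core S" "S \<noteq> {}"
  obtains u v1 v2 v3 w1 w2 w3 s where "cube u v1 v2 v3 w1 w2 w3 s"
    "\<Union> (set (antipodal_pairs u v1 v2 v3 w1 w2 w3 s)) \<subseteq> S"
proof -
  obtain e where e: "e \<in> S" using assms(2) by blast
  then have "e \<in> edges G" using assms(1) by (auto simp: core_def)
  then obtain u v1 where "e = {u, v1}" by (rule edgeE)
  with e have uv1: "{u, v1} \<in> S" by simp
  obtain v2 v3 where Nu: "{y. adj u y} = {v1, v2, v3}" and dv: "distinct [v1, v2, v3]"
    using core_degree[OF assms(1) uv1] .
  have a: "adj u v1" "adj u v2" "adj u v3" using Nu by auto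
  have flip: "{x, y} \<in> S \<Longrightarrow> {y, x} \<in> S" for x y
    by (simp add: insert_commute)
  obtain w3 where w3: "adj v1 w3" "w3 \<noteq> u" "adj v2 w3" "\<not> adj v2 v1"
      "{u, v2} \<in> S" "{v1, w3} \<in> S" "{v2, w3} \<in> S"
    using core_square[OF assms(1) uv1 a(2)] dv by auto
  obtain w2 where w2: "adj v1 w2" "w2 \<noteq> u" "adj v3 w2" "\<not> adj v3 v1"
      "{u, v3} \<in> S" "{v1, w2} \<in> S" "{v3, w2} \<in> S"
    using core_square[OF assms(1) uv1 a(3)] dv by auto
  obtain w1 where w1: "adj v2 w1" "w1 \<noteq> u" "adj v3 w1" "\<not> adj v3 v2"
      "{v2, w1} \<in> S" "{v3, w1} \<in> S"
    using core_square[OF assms(1) w3(5) a(3)] dv by auto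
  have no_K23: "\<not> (adj z v1 \<and> adj z v2 \<and> adj z v3)" if "z \<noteq> u" for z
    using K23_not_core[OF assms(1) dv, of u z] a uv1 that by auto
  \<comment> \<open>Two equal ones would be a vertex other than \<open>u\<close> adjacent to all of \<open>v1\<close>, \<open>v2\<close>, \<open>v3\<close>.\<close>
  have dw: "distinct [w1, w2, w3]"
    using no_K23[of w1] no_K23[of w2] w1(1-3) w2(1-3) w3(1-3) adj_sym by auto
  have N1: "{y. adj v1 y} = {u, w2, w3}" 
    by (intro nbrs_eqI; use a w1 w2 w3 dw adj_sym in simp)
  have N2: "{y. adj v2 y} = {u, w1, w3}"
    by (intro nbrs_eqI; use a w1 w2 w3 dw adj_sym in simp)
  have N3: "{y. adj v3 y} = {u, w1, w2}"
    by (intro nbrs_eqI; use a w1 w2 w3 dw adj_sym in simp)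
  have off: "\<not> adj v1 w1" "\<not> adj v2 w2" "\<not> adj v3 w3"
    using N1 N2 N3 dw w1(2) w2(2) w3(2) by auto
  have w31: "adj w3 v1" "adj w3 v2" "adj w2 v1" "adj w2 v3" "adj w1 v2" "adj w1 v3"
    using w1 w2 w3 adj_sym by auto
  obtain s where s: "adj w3 s" "s \<noteq> v1" "adj w2 s" "{w3, s} \<in> S" "{w2, s} \<in> S"
    using core_square[OF assms(1) w3(6) w2(1)] dw by auto
  have s2: "s \<noteq> v2"
    using off(2) adj_sym[OF s(3)] by blast
  have N3': "{y. adj w3 y} = {v1, v2, s}"
    by (intro nbrs_eqI; use w31 s s2 dv in simp)
  have "w1 \<noteq> w3" using dw by simp
  then obtain s' where s': "adj w3 s'" "s' \<noteq> v2" "adj w1 s'" "{w1, s'} \<in> S"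
    by (rule core_square[OF assms(1) w3(7) w1(1)], intro that)
  have "s' = v1 \<or> s' = v2 \<or> s' = s"
    using N3' s'(1) by blast
  moreover have "s' \<noteq> v1"
    using off(1) adj_sym[OF s'(3)] by blast
  ultimately have "s' = s"
    using s'(2) by blast
  with s' have s1: "adj w1 s" "{w1, s} \<in> S" by auto
  have s3: "s \<noteq> v3"
    using off(3) adj_sym[OF s(1)] by blast
  have wv: "w1 \<noteq> v1" "w2 \<noteq> v2" "w3 \<noteq> v3"
    using w1(1,4) w2(3) w3(3,4) adj_sym[of v2 v3] by blast+
  then have "w1 \<notin> {v1, v2, v3}" "w2 \<notin> {v1, v2, v3}" "w3 \<notin> {v1, v2, v3}"
    using w31[THEN adj_neq] by auto
  moreover from this have "s \<noteq> u"
    using Nu adj_sym[OF s1(1)] by blast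
  ultimately have "distinct [u, v1, v2, v3, w1, w2, w3, s]"
    using dv dw a[THEN adj_neq] w1(2) w2(2) w3(2) s(1,3)[THEN adj_neq] s1(1)[THEN adj_neq] s(2) s2 s3
    by auto
  then have "cube u v1 v2 v3 w1 w2 w3 s"
    unfolding cube_def using a w1 w2 w3 s s1 adj_sym by simp
  moreover have "\<Union> (set (antipodal_pairs u v1 v2 v3 w1 w2 w3 s)) \<subseteq> S"
    using uv1 w1(5,6) w2(5-7) w3(5-7) s(4,5) s1(2)
    by (simp add: antipodal_pairs_def insert_commute)
  ultimately show ?thesis
    by (rule that)
qed

text \<open>Induction on \<open>S\<close>: outside of a core some edge can be colored last, and from a core a cube can be split
  off.\<close>

lemma coloring_exists:
  assumes "S \<subseteq> edges G"
  shows "\<exists>c :: 'a set \<Rightarrow> nat. c ` S \<subseteq> {..<6} \<and> (\<forall>e\<in>S. \<forall>f\<in>S. conflict G e f \<longrightarrow> c e \<noteq> c f)"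
proof -
  have "finite S" using assms finite_edges by (rule finite_subset)
  then show ?thesis
    using assms
  proof (induction S rule: finite_psubset_induct)
    case (psubset S)
    have colors: "\<exists>c :: 'a set \<Rightarrow> nat. c ` T \<subseteq> {..<6} \<and>
      (\<forall>e\<in>T. \<forall>f\<in>T. conflict G e f \<longrightarrow> c e \<noteq> c f)" if "T \<subset> S" for T
      using psubset.IH[OF that] psubset.prems that by blast
    show ?case
    proof (cases "core S")
      case False
      then obtain e where e: "e \<in> S" "card {f \<in> S. conflict G e f} < 6"
        using psubset.prems by (auto simp: core_def not_le)
      have "S - {e} \<subset> S" using e(1) by blast
      from colors[OF this]
      obtain c :: "'a set \<Rightarrow> nat" where c6: "c ` (S - {e}) \<subseteq> {..<6}"
        and cc: "\<forall>f\<in>S - {e}. \<forall>g\<in>S - {e}. conflict G f g \<longrightarrow> c f \<noteq> c g"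
        by (elim exE conjE)
      have fin: "finite (c ` {f \<in> S. conflict G e f})"
        using psubset.hyps by simp
      have "card (c ` {f \<in> S. conflict G e f}) < card {..<6 :: nat}"
        using e(2) card_image_le[of "{f \<in> S. conflict G e f}" c] psubset.hyps by simp
      then have "\<not> {..<6} \<subseteq> c ` {f \<in> S. conflict G e f}"
        using card_mono[OF fin] by (metis not_le)
      then obtain i where i: "i \<in> {..<6}" "i \<notin> c ` {f \<in> S. conflict G e f}"
        by (meson subsetI)
      have fresh: "c f \<noteq> i" if "f \<in> S" "conflict G e f" for f
        using i(2) that by auto
      let ?c = "c(e := i)"
      have "?c f \<noteq> ?c g" if fg: "f \<in> S" "g \<in> S" "conflict G f g" for f g
      proof -
        have "f \<noteq> g" using fg(3) by (simp add: conflict_def)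
        then consider "f = e" "g \<noteq> e" | "f \<noteq> e" "g = e" | "f \<noteq> e" "g \<noteq> e" by blast
        then show ?thesis
        proof cases
          case 1
          then show ?thesis using fresh[of g] fg by simp
        next
          case 2
          then show ?thesis using fresh[of f] fg conflict_sym[OF fg(3)] by simp
        next
          case 3
          then show ?thesis using cc[rule_format, of f g] fg by simp
        qed
      qed
      moreover have "?c ` S \<subseteq> {..<6}"
        using c6 i(1) by auto
      ultimately show ?thesis by blast
    next
      case True
      show ?thesis
      proof (cases "S = {}")
        case False
        obtain u v1 v2 v3 w1 w2 w3 s where cube: "cube u v1 v2 v3 w1 w2 w3 s"
          and sub: "\<Union> (set (antipodal_pairs u v1 v2 v3 w1 w2 w3 s)) \<subseteq> S"
          using core_cube[OF True False] .
        let ?P = "antipodal_pairs u v1 v2 v3 w1 w2 w3 s"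
        let ?C = "\<Union> (set ?P)"
        have conf: "f \<in> ?C - Q" if "Q \<in> set ?P" "e \<in> Q" "f \<in> S" "conflict G e f" for Q e f
          using antipodal_pairs_conflict[OF cube that(1,2,4)] that(3) psubset.prems by blast
        have "?C \<noteq> {}" by (simp add: antipodal_pairs_def)
        with sub have "S - ?C \<subset> S" by blast
        from colors[OF this]
        obtain c :: "'a set \<Rightarrow> nat" where c6: "c ` (S - ?C) \<subseteq> {..<6}"
          and cc: "\<forall>f\<in>S - ?C. \<forall>g\<in>S - ?C. conflict G f g \<longrightarrow> c f \<noteq> c g"
          by (elim exE conjE)
        have len: "length ?P = 6" by (simp add: antipodal_pairs_def)
        have "\<exists>i<6. e \<in> ?P ! i" if "e \<in> ?C" for e
          using that len by (metis Union_iff in_set_conv_nth)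
        then obtain k where k: "\<And>e. e \<in> ?C \<Longrightarrow> k e < 6 \<and> e \<in> ?P ! k e"
          by metis
        let ?c = "\<lambda>e. if e \<in> ?C then k e else c e"
        have "?c e \<noteq> ?c f" if "e \<in> S" "f \<in> S" "conflict G e f" for e f
        proof (cases "e \<in> ?C")
          case True
          then have "f \<in> ?C - ?P ! k e"
            using conf[of "?P ! k e" e f] k[OF True] len that by simp
          then show ?thesis using True k[of f] by auto
        next
          case e: False
          have "f \<notin> ?C"
          proof
            assume "f \<in> ?C"
            then show False
              using conf[of "?P ! k f" f e] k[of f] len that e conflict_sym[OF that(3)] by auto
          qed
          then show ?thesis using cc[rule_format, of e f] that e by simp
        qed
        moreover have "?c ` S \<subseteq> {..<6}"
          using c6 k by auto
        ultimately show ?thesis by blast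
      qed simp
    qed
  qed
qed

lemma q_B_le_6: "q_B G \<le> 6"
proof -
  obtain c :: "'a set \<Rightarrow> nat" where c: "c ` edges G \<subseteq> {..<6}"
    "\<forall>e\<in>edges G. \<forall>f\<in>edges G. conflict G e f \<longrightarrow> c e \<noteq> c f"
    using coloring_exists[OF subset_refl] by blast
  then have "B_coloring G c"
    by (intro B_coloringI) blast
  with c(1) show ?thesis
    unfolding q_B_def by (intro Least_le) blast
qed

end

section \<open>A planar graph that needs six colors\<close>

definition K4 :: "nat graph" where
  "K4 = ({0, 1, 2, 3}, {{0, 1}, {0, 2}, {0, 3}, {1, 2}, {1, 3}, {2, 3}})"

lemma simple_K4: "simple_graph K4"
  by (simp add: simple_graph_def K4_def)

lemma subcubic_K4: "subcubic K4"
proof -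
  have "{e \<in> edges K4. v \<in> e} \<subseteq> (\<lambda>w. {v, w}) ` (verts K4 - {v})" if "v \<in> verts K4" for v
  proof
    fix e assume "e \<in> {e \<in> edges K4. v \<in> e}"
    then have "e \<subseteq> verts K4" "card e = 2" "v \<in> e"
      using simple_K4 by (auto simp: simple_graph_def)
    then show "e \<in> (\<lambda>w. {v, w}) ` (verts K4 - {v})"
      by (auto simp: card_2_iff)
  qed
  then have "vdegree K4 v \<le> card (verts K4 - {v})" if "v \<in> verts K4" for v
    unfolding vdegree_def using that
    by (meson card_image_le card_mono finite_Diff finite_imageI order_trans simple_graph_def simple_K4)
  moreover have "card (verts K4 - {v}) = 3" if "v \<in> verts K4" for v
    using that by (simp add: card_Diff_singleton) (simp add: K4_def)
  ultimately show ?thesis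
    by (simp add: subcubic_def)
qed

text \<open>The vertex 0 is inside the triangle formed by the other three, so that straight edges do not cross.\<close>

definition K4_point :: "nat \<Rightarrow> complex" where
  "K4_point v = (if v = 0 then 0 else if v = 1 then 1 else if v = 2 then \<i> else Complex (-1) (-1))"

lemma planar_K4: "planar K4"
proof -
  define \<gamma> where "\<gamma> e = linepath (K4_point (Min e)) (K4_point (Max e))" for e
  have "plane_drawing K4 K4_point \<gamma>"
    unfolding plane_drawing_def
  proof (intro conjI)
    show "inj_on K4_point (verts K4)"
      by (auto simp: inj_on_def K4_def K4_point_def complex_eq_iff)
    show "\<forall>e\<in>edges K4. arc (\<gamma> e) \<and> {pathstart (\<gamma> e), pathfinish (\<gamma> e)} = K4_point ` e \<and>
        path_image (\<gamma> e) \<inter> K4_point ` verts K4 = K4_point ` e"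
      by (simp add: K4_def \<gamma>_def arc_linepath K4_point_def complex_eq_iff in_segment)
        (auto simp: complex_eq_iff in_segment)
    have seg: "path_image (\<gamma> {0, 1}) = {z. Im z = 0 \<and> 0 \<le> Re z \<and> Re z \<le> 1}"
      "path_image (\<gamma> {0, 2}) = {z. Re z = 0 \<and> 0 \<le> Im z \<and> Im z \<le> 1}"
      "path_image (\<gamma> {0, 3}) = {z. Re z = Im z \<and> -1 \<le> Re z \<and> Re z \<le> 0}"
      "path_image (\<gamma> {1, 2}) = {z. Re z + Im z = 1 \<and> 0 \<le> Re z \<and> 0 \<le> Im z}"
      "path_image (\<gamma> {1, 3}) = {z. Re z = 1 + 2 * Im z \<and> -1 \<le> Im z \<and> Im z \<le> 0}"
      "path_image (\<gamma> {2, 3}) = {z. Im z = 1 + 2 * Re z \<and> -1 \<le> Re z \<and> Re z \<le> 0}"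
    proof -
      have image: "path_image (\<gamma> {v, w}) = S" if "v < w"
        and "\<And>u. 0 \<le> u \<Longrightarrow> u \<le> 1 \<Longrightarrow> (1 - u) *\<^sub>R K4_point v + u *\<^sub>R K4_point w \<in> S"
        and "\<And>z. z \<in> S \<Longrightarrow> 0 \<le> t z \<and> t z \<le> 1 \<and> z = (1 - t z) *\<^sub>R K4_point v + t z *\<^sub>R K4_point w"
      for v w S t
      proof -
        have "path_image (\<gamma> {v, w}) = closed_segment (K4_point v) (K4_point w)"
          using that(1) by (simp add: \<gamma>_def)
        also have "\<dots> = S"
          using that(2,3) unfolding closed_segment_def by blast
        finally show ?thesis .
      qed
      show "path_image (\<gamma> {0, 1}) = {z. Im z = 0 \<and> 0 \<le> Re z \<and> Re z \<le> 1}"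
        by (rule image[where t = Re]) (auto simp: K4_point_def complex_eq_iff)
      show "path_image (\<gamma> {0, 2}) = {z. Re z = 0 \<and> 0 \<le> Im z \<and> Im z \<le> 1}"
        by (rule image[where t = Im]) (auto simp: K4_point_def complex_eq_iff)
      show "path_image (\<gamma> {0, 3}) = {z. Re z = Im z \<and> -1 \<le> Re z \<and> Re z \<le> 0}"
        by (rule image[where t = "\<lambda>z. - Re z"]) (auto simp: K4_point_def complex_eq_iff)
      show "path_image (\<gamma> {1, 2}) = {z. Re z + Im z = 1 \<and> 0 \<le> Re z \<and> 0 \<le> Im z}"
        by (rule image[where t = Im]) (auto simp: K4_point_def complex_eq_iff)
      show "path_image (\<gamma> {1, 3}) = {z. Re z = 1 + 2 * Im z \<and> -1 \<le> Im z \<and> Im z \<le> 0}"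
        by (rule image[where t = "\<lambda>z. - Im z"]) (auto simp: K4_point_def complex_eq_iff)
      show "path_image (\<gamma> {2, 3}) = {z. Im z = 1 + 2 * Re z \<and> -1 \<le> Re z \<and> Re z \<le> 0}"
        by (rule image[where t = "\<lambda>z. - Re z"]) (auto simp: K4_point_def complex_eq_iff)
    qed
    have meet: "path_image (\<gamma> {0, 1}) \<inter> path_image (\<gamma> {0, 2}) = {K4_point 0}"
      "path_image (\<gamma> {0, 1}) \<inter> path_image (\<gamma> {0, 3}) = {K4_point 0}"
      "path_image (\<gamma> {0, 1}) \<inter> path_image (\<gamma> {1, 2}) = {K4_point 1}"
      "path_image (\<gamma> {0, 1}) \<inter> path_image (\<gamma> {1, 3}) = {K4_point 1}"
      "path_image (\<gamma> {0, 1}) \<inter> path_image (\<gamma> {2, 3}) = {}"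
      "path_image (\<gamma> {0, 2}) \<inter> path_image (\<gamma> {0, 3}) = {K4_point 0}"
      "path_image (\<gamma> {0, 2}) \<inter> path_image (\<gamma> {1, 2}) = {K4_point 2}"
      "path_image (\<gamma> {0, 2}) \<inter> path_image (\<gamma> {1, 3}) = {}"
      "path_image (\<gamma> {0, 2}) \<inter> path_image (\<gamma> {2, 3}) = {K4_point 2}"
      "path_image (\<gamma> {0, 3}) \<inter> path_image (\<gamma> {1, 2}) = {}"
      "path_image (\<gamma> {0, 3}) \<inter> path_image (\<gamma> {1, 3}) = {K4_point 3}"
      "path_image (\<gamma> {0, 3}) \<inter> path_image (\<gamma> {2, 3}) = {K4_point 3}"
      "path_image (\<gamma> {1, 2}) \<inter> path_image (\<gamma> {1, 3}) = {K4_point 1}"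
      "path_image (\<gamma> {1, 2}) \<inter> path_image (\<gamma> {2, 3}) = {K4_point 2}"
      "path_image (\<gamma> {1, 3}) \<inter> path_image (\<gamma> {2, 3}) = {K4_point 3}"
      unfolding seg K4_point_def by (auto simp: complex_eq_iff)
    show "\<forall>e\<in>edges K4. \<forall>f\<in>edges K4. e \<noteq> f \<longrightarrow>
        path_image (\<gamma> e) \<inter> path_image (\<gamma> f) = K4_point ` (e \<inter> f)"
      by (simp add: K4_def doubleton_eq_iff meet meet[THEN trans[OF Int_commute]] del: One_nat_def)
  qed
  then show ?thesis
    by (auto simp: planar_def)
qed

lemma q_B_K4: "6 \<le> q_B K4"
proof -
  obtain c where c: "B_coloring K4 c" "c ` edges K4 \<subseteq> {..<q_B K4}"
    using q_B_attained[OF simple_K4] by blast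
  have cycle: "distinct [c {u, v}, c {v, w}, c {w, x}, c {x, u}]"
    if "distinct [u, v, w, x]" "{u, v, w, x} \<subseteq> {0, 1, 2, 3}" for u v w x
  proof -
    have "four_cycle K4 u v w x"
      using that by (auto simp: four_cycle_def K4_def insert_commute)
    then show ?thesis
      using c(1) by (simp add: B_coloring_def)
  qed
  have "distinct [c {0, 1}, c {0, 2}, c {0, 3}, c {1, 2}, c {1, 3}, c {2, 3}]"
    using cycle[of 0 1 2 3] cycle[of 0 1 3 2] cycle[of 0 2 1 3]
    by (simp add: insert_commute) metis
  then have "card (c ` edges K4) = 6"
    by (simp add: K4_def)
  with card_mono[OF _ c(2)] show ?thesis
    by simp
qed

lemma q_B_le_6_if_planar:
  assumes "simple_graph G" "subcubic G" "planar G"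
  shows "q_B G \<le> 6"
  using assms planar_no_K33[of G]
  by (intro subcubic_K33_free.q_B_le_6) (simp add: subcubic_K33_free_def)

theorem theorem1p5:
  shows "(\<forall>G :: 'a graph. simple_graph G \<and> subcubic G \<and> planar G \<longrightarrow> q_B G \<le> 6) \<and>
    (\<exists>G :: nat graph. simple_graph G \<and> subcubic G \<and> planar G \<and> q_B G = 6)"
proof
  show "\<forall>G :: 'a graph. simple_graph G \<and> subcubic G \<and> planar G \<longrightarrow> q_B G \<le> 6"
    using q_B_le_6_if_planar by blast
  show "\<exists>G :: nat graph. simple_graph G \<and> subcubic G \<and> planar G \<and> q_B G = 6"
    using q_B_le_6_if_planar[OF simple_K4 subcubic_K4 planar_K4] q_B_K4 simple_K4 subcubic_K4 planar_K4
    by (intro exI[of _ K4]) simp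
qed

end
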